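(* Let $\sigma=(\sigma_1,\dots,\sigma_l)$ be a node of the PI-B\&B tree. For each $p\in\{1,\dots,l\}$ and each subset $\Omega\subseteq\overline{J}_{\sigma}$, a valid lower bound on the optimal value of the subproblem associated with node $\sigma$ is given by $$L_2(\sigma,p,\Omega)=z(\sigma)+\max\left\{0,\ |T_{\sigma_p}|+\min_{S\subseteq\Omega}\left\{|\overrightarrow{\Gamma}_{\sigma,p,S}|+|\overleftarrow{\Gamma}_{\sigma,p,\Omega\setminus S}|+|\Gamma_{\sigma,\Omega,S}|\right\}+\gamma_{\sigma,p}-c\right\},$$ where $$\overrightarrow{\Gamma}_{\sigma,p,S}=\left[\left(\bigcup_{j\in S}T_j\right)\cap T_{\sigma_{\overrightarrow{p}}}\right]\setminus T_{\sigma_{\overleftarrow{p}}},$$ $$\overleftarrow{\Gamma}_{\sigma,p,\Omega\setminus S}=\left[\left(\bigcup_{j\in\Omega\setminus S}T_j\right)\cap T_{\sigma_{\overleftarrow{p}}}\right]\setminus T_{\sigma_{\overrightarrow{p}}},$$ $$\Gamma_{\sigma,\Omega,S}=\left[\left(\bigcup_{j\in S}T_j\right)\cap\left(\bigcup_{j\in\Omega\setminus S}T_j\right)\right]\setminus T_\sigma,$$ $$\gamma_{\sigma,p}=\max\left\{\left|\left(T_{\sigma_{\overleftarrow{p}}}\cap T_{\sigma_{\overrightarrow{p}}}\right)\setminus T_{\sigma_p}\right|-\left(z(\sigma)-|T_\sigma|+c\right),\ 0\right\}.$$ That is, $L_2(\sigma,p,\Omega)\le z(\overline{\sigma})$ for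 every completion $\overline{\sigma}$ of $\sigma$.
   Context: Job Sequencing and Tool Switching Problem (SSP). We are given tools $T=\{1,\dots,m\}$, jobs $J=\{1,\dots,n\}$, a magazine capacity $c<m$, and for each job $j\in J$ a required toolset $T_j\subseteq T$ with $|T_j|\le c$. Every tool is required by some job: $T=\bigcup_{j\in J}T_j$. A (partial) sequence $\sigma=(\sigma_1,\dots,\sigma_l)$ consists of pairwise distinct jobs. Let $J_\sigma=\{\sigma_1,\dots,\sigma_l\}$, $\overline{J}_\sigma=J\setminus J_\sigma$, and $T_\sigma=\bigcup_{j\in J_\sigma}T_j$. For $p\in\{1,\dots,l\}$, $\sigma_{\overleftarrow{p}}=(\sigma_1,\dots,\sigma_p)$ and $\sigma_{\overrightarrow{p}}=(\sigma_p,\dots,\sigma_l)$, so that $T_{\sigma_{\overleftarrow{p}}}=\bigcup_{k=1}^{p}T_{\sigma_k}$ and $T_{\sigma_{\overrightarrow{p}}}=\bigcup_{k=p}^{l}T_{\sigma_k}$. A magazine configuration is a set $M\subseteq T$ with $|M|=c$. A sequence of magazine configurations $\mathcal{M}=(M_1,\dots,M_l)$ covers $\sigma$ if $T_{\sigma_i}\subseteq M_i$ for $i=1,\dots,l$. Its number of tool switches is $z(\mathcal{M})=\sum_{i=2}^{l}|M_i\setminus M_{i-1}|$ (so the initial loading is free). Let $z(\sigma)$ be the minimum of $z(\mathcal{M})$ over all $\mathcal{M}$ covering $\sigma$. The SSP asks for a permutation of $J$ minimizing $z$. PI-B\&B tree. Nodes are partial sequences of jobs. The root (level $0$) is a sequence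 $(\sigma_1,\sigma_2)$ of two distinct jobs chosen to maximize $|T_{\sigma_1}\setminus T_{\sigma_2}|+|T_{\sigma_2}\setminus T_{\sigma_1}|$. At a node $\sigma=(\sigma_1,\dots,\sigma_l)$ with $\overline{J}_\sigma\neq\emptyset$, one job $j\in\overline{J}_\sigma$ maximizing $\min_{i\in\{1,\dots,l\}}|T_{\sigma_i}\cup T_j|$ is selected (ties broken in some fixed way), and the $l+1$ children of $\sigma$ are the sequences obtained by inserting $j$ into $\sigma$ at each of the $l+1$ possible positions. Leaves are complete sequences of $n$ jobs. A completion of a node $\sigma$ is any leaf of the subtree rooted at $\sigma$, i.e. any permutation of $J$ obtainable from $\sigma$ by such insertions; equivalently, any permutation of $J$ in which the jobs of $J_\sigma$ appear in the same relative order as in $\sigma$. The optimal value of the subproblem at node $\sigma$ is the minimum of $z(\overline{\sigma})$ over all completions $\overline{\sigma}$ of $\sigma$. *)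

theory Defs
  imports Main
begin

text \<open>
  Tools are \<open>{1..m}\<close>, jobs are \<open>{1..n}\<close>, \<open>c\<close> is the magazine capacity and \<open>R j\<close> is the
  set of tools required by job \<open>j\<close>.
\<close>

definition ssp_instance :: "nat \<Rightarrow> nat \<Rightarrow> nat \<Rightarrow> (nat \<Rightarrow> nat set) \<Rightarrow> bool" where
  "ssp_instance m n c R \<longleftrightarrow>
     c < m \<and>
     (\<forall>j\<in>{1..n}. R j \<subseteq> {1..m} \<and> card (R j) \<le> c) \<and>
     (\<Union>j\<in>{1..n}. R j) = {1..m}"

definition tools_of :: "(nat \<Rightarrow> nat set) \<Rightarrow> nat list \<Rightarrow> nat set" where
  "tools_of R \<sigma> = (\<Union>j\<in>set \<sigma>. R j)"

definition jobs_left :: "nat \<Rightarrow> nat list \<Rightarrow> nat set" where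
  "jobs_left n \<sigma> = {1..n} - set \<sigma>"

text \<open>Positions are counted from 1, whereas list indices start at 0.\<close>

definition job_at :: "nat list \<Rightarrow> nat \<Rightarrow> nat" where
  "job_at \<sigma> p = \<sigma> ! (p - 1)"

definition upto_pos :: "nat list \<Rightarrow> nat \<Rightarrow> nat list" where
  "upto_pos \<sigma> p = take p \<sigma>"

definition from_pos :: "nat list \<Rightarrow> nat \<Rightarrow> nat list" where
  "from_pos \<sigma> p = drop (p - 1) \<sigma>"

definition magazine :: "nat \<Rightarrow> nat \<Rightarrow> nat set \<Rightarrow> bool" where
  "magazine m c M \<longleftrightarrow> M \<subseteq> {1..m} \<and> card M = c"

definition covers :: "nat \<Rightarrow> nat \<Rightarrow> (nat \<Rightarrow> nat set) \<Rightarrow> nat set list \<Rightarrow> nat list \<Rightarrow> bool" where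
  "covers m c R Ms \<sigma> \<longleftrightarrow>
     length Ms = length \<sigma> \<and> (\<forall>M\<in>set Ms. magazine m c M) \<and>
     (\<forall>i<length \<sigma>. R (\<sigma> ! i) \<subseteq> Ms ! i)"

definition switches :: "nat set list \<Rightarrow> nat" where
  "switches Ms = (\<Sum>i\<in>{1..<length Ms}. card (Ms ! i - Ms ! (i - 1)))"

definition min_switches :: "nat \<Rightarrow> nat \<Rightarrow> (nat \<Rightarrow> nat set) \<Rightarrow> nat list \<Rightarrow> nat" where
  "min_switches m c R \<sigma> = Min {switches Ms | Ms. covers m c R Ms \<sigma>}"

definition is_root :: "nat \<Rightarrow> (nat \<Rightarrow> nat set) \<Rightarrow> nat list \<Rightarrow> bool" where
  "is_root n R \<sigma> \<longleftrightarrow>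
     (\<exists>a b. \<sigma> = [a, b] \<and>
        is_arg_max (\<lambda>(a, b). card (R a - R b) + card (R b - R a))
          (\<lambda>(a, b). a \<in> {1..n} \<and> b \<in> {1..n} \<and> a \<noteq> b) (a, b))"

definition branching_job :: "nat \<Rightarrow> (nat \<Rightarrow> nat set) \<Rightarrow> nat list \<Rightarrow> nat \<Rightarrow> bool" where
  "branching_job n R \<sigma> j \<longleftrightarrow>
     is_arg_max (\<lambda>j. Min ((\<lambda>i. card (R i \<union> R j)) ` set \<sigma>)) (\<lambda>j. j \<in> jobs_left n \<sigma>) j"

text \<open>
  The function \<open>sel\<close> gives the job selected at each incomplete node; it carries the tie breaking.
\<close>

definition children :: "nat \<Rightarrow> (nat list \<Rightarrow> nat) \<Rightarrow> nat list \<Rightarrow> nat list set" where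
  "children n sel \<sigma> =
     (if jobs_left n \<sigma> = {} then {}
      else {take i \<sigma> @ sel \<sigma> # drop i \<sigma> | i. i \<le> length \<sigma>})"

inductive_set subtree :: "nat \<Rightarrow> (nat list \<Rightarrow> nat) \<Rightarrow> nat list \<Rightarrow> nat list set"
  for n :: nat and sel :: "nat list \<Rightarrow> nat" and \<sigma> :: "nat list" where
  self: "\<sigma> \<in> subtree n sel \<sigma>"
| child: "\<tau> \<in> subtree n sel \<sigma> \<Longrightarrow> \<upsilon> \<in> children n sel \<tau> \<Longrightarrow> \<upsilon> \<in> subtree n sel \<sigma>"

definition pibb_tree :: "nat \<Rightarrow> (nat \<Rightarrow> nat set) \<Rightarrow> nat list \<Rightarrow> (nat list \<Rightarrow> nat) \<Rightarrow> bool" where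
  "pibb_tree n R root sel \<longleftrightarrow>
     is_root n R root \<and>
     (\<forall>\<sigma>\<in>subtree n sel root. jobs_left n \<sigma> \<noteq> {} \<longrightarrow> branching_job n R \<sigma> (sel \<sigma>))"

definition completions :: "nat \<Rightarrow> (nat list \<Rightarrow> nat) \<Rightarrow> nat list \<Rightarrow> nat list set" where
  "completions n sel \<sigma> = {\<tau> \<in> subtree n sel \<sigma>. jobs_left n \<tau> = {}}"

definition subproblem_opt ::
  "nat \<Rightarrow> nat \<Rightarrow> nat \<Rightarrow> (nat \<Rightarrow> nat set) \<Rightarrow> (nat list \<Rightarrow> nat) \<Rightarrow> nat list \<Rightarrow> nat" where
  "subproblem_opt m n c R sel \<sigma> = Min (min_switches m c R ` completions n sel \<sigma>)"

definition Gamma_right :: "(nat \<Rightarrow> nat set) \<Rightarrow> nat list \<Rightarrow> nat \<Rightarrow> nat set \<Rightarrow> nat set" where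
  "Gamma_right R \<sigma> p S =
     ((\<Union>j\<in>S. R j) \<inter> tools_of R (from_pos \<sigma> p)) - tools_of R (upto_pos \<sigma> p)"

definition Gamma_left :: "(nat \<Rightarrow> nat set) \<Rightarrow> nat list \<Rightarrow> nat \<Rightarrow> nat set \<Rightarrow> nat set" where
  "Gamma_left R \<sigma> p S =
     ((\<Union>j\<in>S. R j) \<inter> tools_of R (upto_pos \<sigma> p)) - tools_of R (from_pos \<sigma> p)"

definition Gamma_free :: "(nat \<Rightarrow> nat set) \<Rightarrow> nat list \<Rightarrow> nat set \<Rightarrow> nat set \<Rightarrow> nat set" where
  "Gamma_free R \<sigma> \<Omega> S = ((\<Union>j\<in>S. R j) \<inter> (\<Union>j\<in>\<Omega> - S. R j)) - tools_of R \<sigma>"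

definition gamma :: "nat \<Rightarrow> nat \<Rightarrow> (nat \<Rightarrow> nat set) \<Rightarrow> nat list \<Rightarrow> nat \<Rightarrow> int" where
  "gamma m c R \<sigma> p =
     max (int (card ((tools_of R (upto_pos \<sigma> p) \<inter> tools_of R (from_pos \<sigma> p)) - R (job_at \<sigma> p)))
          - (int (min_switches m c R \<sigma>) - int (card (tools_of R \<sigma>)) + int c)) 0"

definition L2 :: "nat \<Rightarrow> nat \<Rightarrow> (nat \<Rightarrow> nat set) \<Rightarrow> nat list \<Rightarrow> nat \<Rightarrow> nat set \<Rightarrow> int" where
  "L2 m c R \<sigma> p \<Omega> =
     int (min_switches m c R \<sigma>) +
     max 0 (int (card (R (job_at \<sigma> p)))
       + int (Min ((\<lambda>S. card (Gamma_right R \<sigma> p S) + card (Gamma_left R \<sigma> p (\<Omega> - S))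
                        + card (Gamma_free R \<sigma> \<Omega> S)) ` Pow \<Omega>))
       + gamma m c R \<sigma> p - int c)"

lemma finite_switch_counts: "finite {switches Ms | Ms. covers m c R Ms \<sigma>}"
proof -
  have "{Ms. covers m c R Ms \<sigma>} \<subseteq> {Ms. set Ms \<subseteq> Pow {1..m} \<and> length Ms = length \<sigma>}"
    by (auto simp: covers_def magazine_def)
  then have "finite {Ms. covers m c R Ms \<sigma>}"
    using finite_lists_length_eq[of "Pow {1..m}" "length \<sigma>"] finite_subset by blast
  then show ?thesis by simp
qed

lemma ex_covers:
  assumes "ssp_instance m n c R" "set \<sigma> \<subseteq> {1..n}"
  shows "\<exists>Ms. covers m c R Ms \<sigma>"
proof -
  have "\<exists>M. R j \<subseteq> M \<and> magazine m c M" if "j \<in> {1..n}" for j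
    using that assms(1) exists_subset_between[of "R j" c "{1..m}"]
    by (auto simp: ssp_instance_def magazine_def)
  then obtain f where f: "\<And>j. j \<in> {1..n} \<Longrightarrow> R j \<subseteq> f j \<and> magazine m c (f j)"
    by metis
  have "covers m c R (map f \<sigma>) \<sigma>"
    unfolding covers_def
  proof (intro conjI ballI allI impI)
    show "magazine m c M" if "M \<in> set (map f \<sigma>)" for M
      using that f assms(2) by auto
    show "R (\<sigma> ! i) \<subseteq> map f \<sigma> ! i" if "i < length \<sigma>" for i
      using f[of "\<sigma> ! i"] that assms(2) nth_mem[OF that] by (simp add: subset_iff)
  qed simp
  then show ?thesis ..
qed

lemma ex_root_and_selection:
  assumes "ssp_instance m n c R"
  shows "\<exists>root sel. pibb_tree n R root sel"
proof -
  have n: "n \<ge> 2"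
  proof (rule ccontr)
    assume "\<not> n \<ge> 2"
    then consider "n = 0" | "n = 1" by linarith
    then show False
      using assms by cases (auto simp: ssp_instance_def)
  qed
  let ?P = "\<lambda>(a, b). a \<in> {1..n} \<and> b \<in> {1..n} \<and> a \<noteq> b"
  let ?f = "\<lambda>(a, b). card (R a - R b) + card (R b - R a)"
  have "finite (?f ` Collect ?P)"
    by (rule finite_imageI, rule finite_subset[of _ "{1..n} \<times> {1..n}"]) auto
  moreover have "?P (1, 2)" using n by simp
  then have "?f ` Collect ?P \<noteq> {}" by blast
  ultimately have "Max (?f ` Collect ?P) \<in> ?f ` Collect ?P"
    by (rule Max_in)
  then obtain ab where ab: "?P ab" "?f ab = Max (?f ` Collect ?P)" by force
  moreover have "?f x \<le> Max (?f ` Collect ?P)" if "?P x" for x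
    by (rule Max_ge[OF \<open>finite (?f ` Collect ?P)\<close>], rule imageI, rule CollectI, rule that)
  ultimately have "is_arg_max ?f ?P ab"
    unfolding is_arg_max_def by (metis (no_types, lifting) not_less)
  then have root: "is_root n R [fst ab, snd ab]"
    unfolding is_root_def by (cases ab) auto
  have "\<exists>j. branching_job n R \<sigma> j" if "jobs_left n \<sigma> \<noteq> {}" for \<sigma>
  proof -
    let ?g = "\<lambda>j. Min ((\<lambda>i. card (R i \<union> R j)) ` set \<sigma>)"
    have fin: "finite (jobs_left n \<sigma>)" by (simp add: jobs_left_def)
    then have "Max (?g ` jobs_left n \<sigma>) \<in> ?g ` jobs_left n \<sigma>"
      using that by (intro Max_in) auto
    then obtain j where j: "?g j = Max (?g ` jobs_left n \<sigma>)" "j \<in> jobs_left n \<sigma>"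
      by (metis (no_types, lifting) imageE)
    have "?g k \<le> Max (?g ` jobs_left n \<sigma>)" if "k \<in> jobs_left n \<sigma>" for k
      using fin that by (intro Max_ge) auto
    with j have "branching_job n R \<sigma> j"
      unfolding branching_job_def is_arg_max_def by (metis (no_types, lifting) not_less)
    then show ?thesis ..
  qed
  then obtain sel where "\<And>\<sigma>. jobs_left n \<sigma> \<noteq> {} \<Longrightarrow> branching_job n R \<sigma> (sel \<sigma>)"
    by metis
  with root show ?thesis unfolding pibb_tree_def by blast
qed

lemma subtree_trans:
  assumes "\<upsilon> \<in> subtree n sel \<tau>" "\<tau> \<in> subtree n sel \<sigma>"
  shows "\<upsilon> \<in> subtree n sel \<sigma>"
  using assms by (induction rule: subtree.induct) (auto intro: subtree.intros)

lemma childrenE: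
  assumes "\<upsilon> \<in> children n sel \<tau>"
  obtains xs ys where "\<tau> = xs @ ys" "\<upsilon> = xs @ sel \<tau> # ys" "jobs_left n \<tau> \<noteq> {}"
proof -
  from assms obtain i where "\<upsilon> = take i \<tau> @ sel \<tau> # drop i \<tau>" "jobs_left n \<tau> \<noteq> {}"
    by (auto simp: children_def split: if_splits)
  then show thesis using that[of "take i \<tau>" "drop i \<tau>"] by simp
qed

lemma childrenI:
  assumes "\<tau> = xs @ ys" "jobs_left n \<tau> \<noteq> {}"
  shows "xs @ sel \<tau> # ys \<in> children n sel \<tau>"
proof -
  have "xs @ sel \<tau> # ys = take (length xs) \<tau> @ sel \<tau> # drop (length xs) \<tau>"
    using assms(1) by simp
  moreover have "length xs \<le> length \<tau>" using assms(1) by simp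
  ultimately show ?thesis using assms(2) unfolding children_def by auto
qed

lemma subtree_invariant:
  assumes "\<tau> \<in> subtree n sel \<sigma>"
    and "\<And>\<tau>. \<tau> \<in> subtree n sel \<sigma> \<Longrightarrow> jobs_left n \<tau> \<noteq> {} \<Longrightarrow> sel \<tau> \<in> jobs_left n \<tau>"
    and "distinct \<sigma>" "set \<sigma> \<subseteq> {1..n}"
  shows "distinct \<tau> \<and> set \<tau> \<subseteq> {1..n} \<and> set \<sigma> \<subseteq> set \<tau> \<and> filter (\<lambda>j. j \<in> set \<sigma>) \<tau> = \<sigma>"
  using assms(1)
proof (induction rule: subtree.induct)
  case self
  then show ?case using assms(3,4) by simp
next
  case (child \<tau> \<upsilon>)
  from child.hyps(2) obtain xs ys where xy:
    "\<tau> = xs @ ys" "\<upsilon> = xs @ sel \<tau> # ys" "jobs_left n \<tau> \<noteq> {}" by (rule childrenE)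
  have s: "sel \<tau> \<in> {1..n}" "sel \<tau> \<notin> set \<tau>"
    using assms(2)[OF child.hyps(1) xy(3)] by (auto simp: jobs_left_def)
  then have "sel \<tau> \<notin> set \<sigma>" using child.IH by blast
  then show ?case using child.IH s xy(1) unfolding xy(2) by auto
qed

lemma completions_eq:
  assumes "\<And>\<tau>. \<tau> \<in> subtree n sel \<sigma> \<Longrightarrow> jobs_left n \<tau> \<noteq> {} \<Longrightarrow> sel \<tau> \<in> jobs_left n \<tau>"
    and "distinct \<sigma>" "set \<sigma> \<subseteq> {1..n}"
  shows "completions n sel \<sigma> =
    {\<tau>. distinct \<tau> \<and> set \<tau> = {1..n} \<and> filter (\<lambda>j. j \<in> set \<sigma>) \<tau> = \<sigma>}"
proof (intro equalityI subsetI)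
  fix \<tau> assume "\<tau> \<in> completions n sel \<sigma>"
  then show "\<tau> \<in> {\<tau>. distinct \<tau> \<and> set \<tau> = {1..n} \<and> filter (\<lambda>j. j \<in> set \<sigma>) \<tau> = \<sigma>}"
    using subtree_invariant[OF _ assms, of \<tau>] by (auto simp: completions_def jobs_left_def)
next
  fix \<tau> assume "\<tau> \<in> {\<tau>. distinct \<tau> \<and> set \<tau> = {1..n} \<and> filter (\<lambda>j. j \<in> set \<sigma>) \<tau> = \<sigma>}"
  then have \<tau>: "distinct \<tau>" "set \<tau> = {1..n}" "filter (\<lambda>j. j \<in> set \<sigma>) \<tau> = \<sigma>" by auto
  have "\<tau> \<in> subtree n sel \<sigma>"
    using assms \<tau>(3)
  proof (induction "card (jobs_left n \<sigma>)" arbitrary: \<sigma>)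
    case 0
    then have "set \<sigma> = {1..n}" by (auto simp: jobs_left_def)
    then have "filter (\<lambda>j. j \<in> set \<sigma>) \<tau> = \<tau>" using \<tau>(2) by (auto simp: filter_id_conv)
    then show ?case using "0.prems"(4) subtree.self by metis
  next
    case (Suc k)
    have ne: "jobs_left n \<sigma> \<noteq> {}" using Suc.hyps(2) by force
    define s where "s = sel \<sigma>"
    have s: "s \<in> jobs_left n \<sigma>"
      unfolding s_def using Suc.prems(1)[OF subtree.self ne] .
    then have "s \<in> set \<tau>" using \<tau>(2) by (auto simp: jobs_left_def)
    then obtain as bs where ab: "\<tau> = as @ s # bs" by (meson split_list)
    define f where "f = filter (\<lambda>j. j \<in> set \<sigma>)"
    define \<upsilon> where "\<upsilon> = f as @ s # f bs"
    have sf: "\<sigma> = f as @ f bs"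
      using Suc.prems(4) s unfolding ab f_def by (auto simp: jobs_left_def)
    have child: "\<upsilon> \<in> children n sel \<sigma>"
      unfolding \<upsilon>_def s_def by (rule childrenI[OF sf ne])
    have set: "set \<upsilon> = insert s (set \<sigma>)" using arg_cong[OF sf, of set] by (simp add: \<upsilon>_def)
    have left: "jobs_left n \<upsilon> = jobs_left n \<sigma> - {s}" using set by (auto simp: jobs_left_def)
    have ab': "s \<notin> set as" "s \<notin> set bs" using \<tau>(1) ab by auto
    have fs: "filter (\<lambda>j. j \<in> set \<upsilon>) as = f as" "filter (\<lambda>j. j \<in> set \<upsilon>) bs = f bs"
      unfolding f_def set using ab' by (auto intro!: filter_cong)
    then have flt: "filter (\<lambda>j. j \<in> set \<upsilon>) \<tau> = \<upsilon>"
    proof -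
      have "s \<in> set \<upsilon>" unfolding set by simp
      then have "filter (\<lambda>j. j \<in> set \<upsilon>) \<tau> = f as @ s # f bs"
        unfolding ab filter_append filter.simps fs by simp
      then show ?thesis by (simp only: \<upsilon>_def)
    qed
    have "\<tau> \<in> subtree n sel \<upsilon>"
    proof (rule Suc.hyps(1))
      show "k = card (jobs_left n \<upsilon>)" using Suc.hyps(2) s left by simp
      show "sel \<tau>' \<in> jobs_left n \<tau>'" if "\<tau>' \<in> subtree n sel \<upsilon>" "jobs_left n \<tau>' \<noteq> {}" for \<tau>'
        using Suc.prems(1) subtree_trans[OF that(1) subtree.child[OF subtree.self child]] that(2)
        by blast
      show "distinct \<upsilon>" using flt \<tau>(1) by (metis distinct_filter)
      show "set \<upsilon> \<subseteq> {1..n}" using set s Suc.prems(3) by (auto simp: jobs_left_def)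
    qed (rule flt)
    then show ?case using subtree_trans subtree.child[OF subtree.self child] by blast
  qed
  then show "\<tau> \<in> completions n sel \<sigma>" using \<tau>(2) by (simp add: completions_def jobs_left_def)
qed

lemma
  assumes tree: "pibb_tree n R root sel" and node: "\<sigma> \<in> subtree n sel root"
  shows node_distinct: "distinct \<sigma>" and node_jobs: "set \<sigma> \<subseteq> {1..n}"
    and node_completions: "completions n sel \<sigma> =
      {\<tau>. distinct \<tau> \<and> set \<tau> = {1..n} \<and> filter (\<lambda>j. j \<in> set \<sigma>) \<tau> = \<sigma>}"
    and finite_completions: "finite (completions n sel \<sigma>)"
    and completions_nonempty: "completions n sel \<sigma> \<noteq> {}"
proof -
  have sel: "sel \<tau> \<in> jobs_left n \<tau>" if "\<tau> \<in> subtree n sel root" "jobs_left n \<tau> \<noteq> {}" for \<tau>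
    using tree that by (auto simp: pibb_tree_def branching_job_def is_arg_max_def)
  have root: "distinct root" "set root \<subseteq> {1..n}"
    using tree by (auto simp: pibb_tree_def is_root_def is_arg_max_def)
  show d: "distinct \<sigma>" and s: "set \<sigma> \<subseteq> {1..n}"
    using subtree_invariant[OF node sel root] by auto
  show eq: "completions n sel \<sigma> =
      {\<tau>. distinct \<tau> \<and> set \<tau> = {1..n} \<and> filter (\<lambda>j. j \<in> set \<sigma>) \<tau> = \<sigma>}"
    using completions_eq[OF _ d s] sel subtree_trans[OF _ node] by blast
  have "completions n sel \<sigma> \<subseteq> {\<tau>. set \<tau> \<subseteq> {1..n} \<and> length \<tau> = n}"
    unfolding eq by (auto dest: distinct_card)
  then show "finite (completions n sel \<sigma>)"
    using finite_lists_length_eq[of "{1..n}" n] finite_subset by blast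
  have "\<sigma> @ sorted_list_of_set (jobs_left n \<sigma>) \<in> completions n sel \<sigma>"
    unfolding eq using d s by (auto simp: jobs_left_def filter_empty_conv)
  then show "completions n sel \<sigma> \<noteq> {}" by blast
qed

end

theory Submission
  imports Defs
begin

text \<open>
  Fix an optimal magazine sequence for a completion \<open>\<tau>\<close> of \<open>\<sigma>\<close>, let \<open>Q\<close> be its magazine for the job
  \<open>s\<close> at position \<open>p\<close> of \<open>\<sigma>\<close>, and let \<open>S\<close> be the jobs of \<open>\<Omega>\<close> that \<open>\<tau>\<close> places before \<open>s\<close>. Write
  \<open>\<Gamma>\<close> for the union of the three Gamma sets of \<open>S\<close>, and \<open>X\<close> for the tools that \<open>\<sigma>\<close> itself uses on
  both sides of \<open>s\<close> but not at \<open>s\<close>. The sets \<open>R s\<close>, \<open>\<Gamma>\<close> and \<open>X\<close> are disjoint, and every tool of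
  \<open>\<Gamma> \<union> X\<close> is needed in \<open>\<tau>\<close> both before and after \<open>s\<close>: it either occupies a slot of \<open>Q\<close>, next to
  \<open>R s\<close>, or is loaded a second time. With \<open>B = \<Gamma> - Q\<close> and \<open>Y = X - Q\<close> the capacity gives
  \<open>|R s| + |\<Gamma>| \<le> c + |B|\<close> and \<open>|R s| + |\<Gamma>| + |X| \<le> c + |B| + |Y|\<close>.

  Switches are counted through loadings into an initially empty magazine, of which there are
  \<open>z(\<tau>) + c\<close>. Suppose that the outer maximum in the bound is positive; otherwise only
  \<open>z(\<sigma>) \<le> z(\<tau>)\<close> is at stake, which the second estimate below contains.

  If \<open>\<gamma> > 0\<close>, the terms \<open>z(\<sigma>)\<close> cancel in the bound. Each tool of \<open>\<sigma>\<close> is loaded once and each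
  tool of \<open>B \<union> Y\<close> once more, so \<open>z(\<tau>) + c \<ge> |T_\<sigma>| + |B| + |Y|\<close>
  (\<open>card_plus_reloaded_le_loads\<close>).

  If \<open>\<gamma> = 0\<close>, delete each tool of \<open>B\<close> from the magazines on a side of \<open>Q\<close> where no job of \<open>\<sigma>\<close> needs
  it, and then the magazines of the jobs outside \<open>\<sigma>\<close>. This saves \<open>|B|\<close> loadings and leaves
  sets of at most \<open>c\<close> tools that still serve \<open>\<sigma>\<close>. They can be filled up to full magazines
  (\<open>ex_full_magazines\<close>), which yields \<open>z(\<sigma>) \<le> max 0 (z(\<tau>) - |B|)\<close>
  (\<open>min_switches_filter_save\<close>).

  The truncation loses the estimate only when \<open>z(\<sigma>) = 0\<close>; then \<open>|R s| + |\<Gamma>| \<le> m \<le> z(\<tau>) + c\<close>,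
  because all \<open>m\<close> tools get loaded.
\<close>

section \<open>Counting tool loadings\<close>

text \<open>
  Unlike \<open>switches\<close>, this charges for the first magazine, relative to previous contents \<open>P\<close>. With
  \<open>P = {}\<close> it counts the maximal stays of tools, also for sets that do not fill the magazine.
\<close>

primrec loads :: "'a set \<Rightarrow> 'a set list \<Rightarrow> nat" where
  "loads P [] = 0"
| "loads P (N # Ns) = card (N - P) + loads N Ns"

lemma switches_Cons: "switches (M # Ms) = loads M Ms"
proof (induction Ms arbitrary: M)
  case Nil
  then show ?case by (simp add: switches_def)
next
  case (Cons N Ms)
  have "switches (M # N # Ms) =
      (\<Sum>i\<in>{Suc 0..<Suc (Suc (length Ms))}. card ((M # N # Ms) ! i - (M # N # Ms) ! (i - 1)))"
    by (simp add: switches_def)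
  also have "\<dots> = card (N - M) +
      (\<Sum>i\<in>{Suc (Suc 0)..<Suc (Suc (length Ms))}. card ((M # N # Ms) ! i - (M # N # Ms) ! (i - 1)))"
    by (subst sum.atLeast_Suc_lessThan) simp_all
  also have "\<dots> = card (N - M) +
      (\<Sum>i\<in>{Suc 0..<Suc (length Ms)}. card ((N # Ms) ! i - (M # N # Ms) ! i))"
    by (subst sum.shift_bounds_Suc_ivl) simp
  also have "(\<Sum>i\<in>{Suc 0..<Suc (length Ms)}. card ((N # Ms) ! i - (M # N # Ms) ! i)) =
      switches (N # Ms)"
    unfolding switches_def by (rule sum.cong) (auto simp: nth_Cons')
  finally show ?case using Cons.IH by simp
qed

lemma loads_split: "loads P (As @ Q # Bs) = loads P (As @ [Q]) + loads Q Bs"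
  by (induction As arbitrary: P) auto

lemma loads_le_insert_front:
  assumes "finite Q" "\<And>N. N \<in> set Ns \<Longrightarrow> finite N"
  shows "loads P Ns \<le> card (Q - P) + loads Q Ns"
proof (cases Ns)
  case (Cons N Ns')
  then have "finite N" using assms(2) by simp
  then have "card (N - P) \<le> card ((Q - P) \<union> (N - Q))"
    using assms(1) by (intro card_mono) auto
  also have "\<dots> \<le> card (Q - P) + card (N - Q)" by (rule card_Un_le)
  finally show ?thesis using Cons by simp
qed simp

lemma card_Union_le_loads:
  assumes "\<And>N. N \<in> set Ns \<Longrightarrow> finite N"
  shows "card (\<Union>(set Ns) - P) \<le> loads P Ns"
  using assms
proof (induction Ns arbitrary: P)
  case (Cons N Ns)
  have "card (\<Union>(set (N # Ns)) - P) \<le> card ((N - P) \<union> (\<Union>(set Ns) - N))"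
    using Cons.prems by (intro card_mono) auto
  also have "\<dots> \<le> card (N - P) + card (\<Union>(set Ns) - N)" by (rule card_Un_le)
  also have "\<dots> \<le> card (N - P) + loads N Ns" using Cons.IH Cons.prems by simp
  finally show ?case by simp
qed simp

text \<open>
  A tool that is present on both sides of \<open>Q\<close> but not in \<open>Q\<close> itself is loaded at least twice.
\<close>

lemma card_plus_reloaded_le_loads:
  assumes fin: "\<And>N. N \<in> set (As @ Q # Bs) \<Longrightarrow> finite N"
    and V: "V \<subseteq> \<Union>(set (As @ Q # Bs))"
    and D: "D \<subseteq> \<Union>(set As) \<inter> \<Union>(set Bs) - Q"
  shows "card V + card D \<le> loads {} (As @ Q # Bs)"
proof -
  define U1 where "U1 = \<Union>(set (As @ [Q]))"
  define U2 where "U2 = \<Union>(set Bs) - Q"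
  have f: "finite U1" "finite U2" using fin by (auto simp: U1_def U2_def)
  have "card V + card D \<le> card (U1 \<union> U2) + card (U1 \<inter> U2)"
    using f V D by (intro add_mono card_mono) (auto simp: U1_def U2_def)
  also have "\<dots> = card U1 + card U2" using card_Un_Int[OF f] by simp
  also have "\<dots> \<le> loads {} (As @ [Q]) + loads Q Bs"
    using card_Union_le_loads[of "As @ [Q]" "{}"] card_Union_le_loads[of Bs Q] fin
    by (intro add_mono) (auto simp: U1_def U2_def)
  finally show ?thesis by (simp add: loads_split[of "{}" As Q Bs])
qed

text \<open>
  Each tool of \<open>D\<close> absent from \<open>P\<close> causes at least one loading, which disappears when the tool is
  removed everywhere; the loadings of the other tools are unaffected.
\<close>

lemma loads_remove:
  assumes "\<And>N. N \<in> set Ns \<Longrightarrow> finite N" "D \<inter> P = {}" "D \<subseteq> \<Union>(set Ns)"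
  shows "loads P (map (\<lambda>N. N - D) Ns) + card D \<le> loads P Ns"
proof -
  have "loads (P - D) (map (\<lambda>N. N - D) Ns) + card (D \<inter> \<Union>(set Ns) - P) \<le> loads P Ns"
    using assms(1)
  proof (induction Ns arbitrary: P)
    case (Cons N Ns)
    have fN: "finite N" using Cons.prems by simp
    have "card (D \<inter> \<Union>(set (N # Ns)) - P) \<le>
        card ((N - P) \<inter> D \<union> (D \<inter> \<Union>(set Ns) - N))"
      using Cons.prems by (intro card_mono) auto
    also have "\<dots> \<le> card ((N - P) \<inter> D) + card (D \<inter> \<Union>(set Ns) - N)" by (rule card_Un_le)
    finally have 1: "card (D \<inter> \<Union>(set (N # Ns)) - P) \<le>
        card ((N - P) \<inter> D) + card (D \<inter> \<Union>(set Ns) - N)" .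
    have "(N - D) - (P - D) = (N - P) - D" by blast
    moreover have "card ((N - P) \<inter> D) + card ((N - P) - D) = card (N - P)"
      using fN card_Int_Diff[of "N - P" D] by simp
    ultimately have "card ((N - D) - (P - D)) + card ((N - P) \<inter> D) = card (N - P)" by simp
    then show ?case using 1 Cons.IH[of N] Cons.prems by simp
  qed simp
  moreover have "P - D = P" "D \<inter> \<Union>(set Ns) - P = D" using assms(2,3) by auto
  ultimately show ?thesis by simp
qed

section \<open>From partially filled to full magazines\<close>

text \<open>
  Magazines are filled from the last one backwards. If the later loads already number at least
  \<open>c\<close>, the first magazine is completed with tools of the second, so that only tools leaving after
  the first position are paid for. Otherwise all later sets fit together into one constant
  magazine, and the spare room in it is used for tools of the first set: this is where the
  truncated difference comes from.
\<close>

lemma ex_full_magazines: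
  assumes "Ns \<noteq> []" "c \<le> m" "\<And>N. N \<in> set Ns \<Longrightarrow> N \<subseteq> {1..m} \<and> card N \<le> c"
  shows "\<exists>Ms. list_all2 (\<lambda>N M. N \<subseteq> M \<and> magazine m c M) Ns Ms \<and> switches Ms \<le> loads {} Ns - c"
  using assms(1,3)
proof (induction Ns rule: list_nonempty_induct)
  case (single N)
  then obtain M where "N \<subseteq> M" "M \<subseteq> {1..m}" "card M = c"
    using exists_subset_between[of N c "{1..m}"] assms(2) by auto
  then show ?case
    by (intro exI[of _ "[M]"]) (simp add: magazine_def switches_Cons)
next
  case (cons N Ns)
  have finN: "finite X" if "X \<in> set (N # Ns)" for X
    using cons.prems[OF that] finite_subset by blast
  have N: "N \<subseteq> {1..m}" "card N \<le> c" "finite N" using cons.prems finN by auto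
  have prepend: ?case
    if M: "list_all2 (\<lambda>N M. N \<subseteq> M \<and> magazine m c M) Ns (M # Ms)"
      and cost: "card (N - M) + loads M Ms \<le> loads {} (N # Ns) - c" for M Ms
  proof -
    have mag: "M \<subseteq> {1..m}" "card M = c" using M by (auto simp: list_all2_Cons2 magazine_def)
    then have fM: "finite M" using finite_subset by blast
    have "c \<le> card (N \<union> M)" using mag fM N card_mono[of "N \<union> M" M] by auto
    then obtain M' where M': "N \<subseteq> M'" "M' \<subseteq> N \<union> M" "card M' = c"
      using exists_subset_between[of N c "N \<union> M"] N fM by auto
    have fM': "finite M'" using M' N fM finite_subset by blast
    have "card (M - M') = card (M' - M)"
      using card_le_sym_Diff[OF fM fM'] card_le_sym_Diff[OF fM' fM] M'(3) mag(2) by simp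
    also have "\<dots> \<le> card (N - M)" using M'(2) N(3) by (intro card_mono) auto
    finally have "switches (M' # M # Ms) \<le> loads {} (N # Ns) - c"
      using cost by (simp add: switches_Cons)
    then show ?case
      using M M' N mag by (intro exI[of _ "M' # M # Ms"]) (auto simp: magazine_def)
  qed
  from cons.hyps obtain N2 Ns' where Ns: "Ns = N2 # Ns'" by (cases Ns) auto
  have "finite N2" using finN Ns by simp
  \<comment> \<open>Counting every stay of a tool at its end instead of its beginning.\<close>
  have W: "loads {} (N # Ns) = loads {} Ns + card (N - N2)"
    using Ns card_Int_Diff[of N N2] card_Int_Diff[of N2 N] N(3) \<open>finite N2\<close>
    by (simp add: Int_commute)
  show ?case
  proof (cases "c \<le> loads {} Ns")
    case True
    have "N \<subseteq> {1..m} \<and> card N \<le> c" if "N \<in> set Ns" for N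
      using cons.prems that by simp
    then obtain Ms' where Ms': "list_all2 (\<lambda>N M. N \<subseteq> M \<and> magazine m c M) Ns Ms'"
      "switches Ms' \<le> loads {} Ns - c"
      using cons.IH by blast
    then obtain M Ms where "Ms' = M # Ms" using Ns by (cases Ms') auto
    with Ms' have Ms: "list_all2 (\<lambda>N M. N \<subseteq> M \<and> magazine m c M) Ns (M # Ms)"
      "switches (M # Ms) \<le> loads {} Ns - c" by simp_all
    have "N2 \<subseteq> M" using Ms(1) Ns by simp
    then have "card (N - M) \<le> card (N - N2)" using N(3) by (intro card_mono) auto
    then show ?thesis
      using prepend[OF Ms(1)] Ms(2) W True by (simp add: switches_Cons)
  next
    case False
    define U where "U = \<Union>(set Ns)"
    have U: "finite U" "U \<subseteq> {1..m}" "card U \<le> c" "card (N \<union> U) \<le> loads {} (N # Ns)"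
      using finN cons.prems False card_Union_le_loads[of Ns "{}"]
        card_Union_le_loads[of "N # Ns" "{}"]
      by (auto simp: U_def)
    have "\<exists>M. U \<subseteq> M \<and> magazine m c M \<and> card (N - M) \<le> card (N \<union> U) - c"
    proof (cases "card (N \<union> U) \<le> c")
      case True
      then obtain M where "N \<union> U \<subseteq> M" "M \<subseteq> {1..m}" "card M = c"
        using exists_subset_between[of "N \<union> U" c "{1..m}"] assms(2) N U by auto
      moreover from this have "N - M = {}" by blast
      then have "card (N - M) = 0" by (simp only: card.empty)
      ultimately show ?thesis by (intro exI[of _ M]) (simp add: magazine_def)
    next
      case False
      then obtain M where M: "U \<subseteq> M" "M \<subseteq> N \<union> U" "card M = c"
        using exists_subset_between[of U c "N \<union> U"] N U by auto
      have "N - M = (N \<union> U) - M" using M by blast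
      moreover have "card ((N \<union> U) - M) = card (N \<union> U) - c"
        using M N U finite_subset[OF M(2)] by (simp add: card_Diff_subset)
      ultimately show ?thesis using M N U by (intro exI[of _ M]) (auto simp: magazine_def)
    qed
    then obtain M where M: "U \<subseteq> M" "magazine m c M" "card (N - M) \<le> card (N \<union> U) - c"
      by blast
    have "loads M (replicate k M) = 0" for k by (induction k) auto
    moreover have "list_all2 (\<lambda>N M. N \<subseteq> M \<and> magazine m c M) Ns (M # replicate (length Ns') M)"
    proof -
      have "M # replicate (length Ns') M = replicate (length Ns) M" by (simp add: Ns)
      moreover have "Ns ! i \<subseteq> M" if "i < length Ns" for i
        using M(1) nth_mem[OF that] unfolding U_def by blast
      ultimately show ?thesis using M(2) by (simp add: list_all2_conv_all_nth)
    qed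
    ultimately show ?thesis using prepend M(3) U(4) by force
  qed
qed

lemma min_switches_le: "covers m c R Ms \<sigma> \<Longrightarrow> min_switches m c R \<sigma> \<le> switches Ms"
  unfolding min_switches_def by (rule Min_le[OF finite_switch_counts]) blast

lemma min_switches_le_loads:
  assumes "\<sigma> \<noteq> []" "c \<le> m"
    and Ns: "list_all2 (\<lambda>j N. R j \<subseteq> N \<and> N \<subseteq> {1..m} \<and> card N \<le> c) \<sigma> Ns"
  shows "min_switches m c R \<sigma> \<le> loads {} Ns - c"
proof -
  have "Ns \<noteq> []" using assms(1) Ns by auto
  moreover have "N \<subseteq> {1..m} \<and> card N \<le> c" if "N \<in> set Ns" for N
    using that Ns by (auto simp: list_all2_conv_all_nth in_set_conv_nth)
  ultimately obtain Ms where Ms: "list_all2 (\<lambda>N M. N \<subseteq> M \<and> magazine m c M) Ns Ms"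
    "switches Ms \<le> loads {} Ns - c"
    using ex_full_magazines[OF _ assms(2), of Ns] by blast
  have "covers m c R Ms \<sigma>"
    using Ns Ms(1) unfolding covers_def list_all2_conv_all_nth
    by (auto simp: in_set_conv_nth) blast
  then show ?thesis using min_switches_le Ms(2) order_trans by blast
qed

text \<open>
  Skipping positions never creates loadings, by the triangle inequality for set differences.
\<close>

lemma ex_cover_of_filter:
  assumes "list_all2 (\<lambda>j N. finite N \<and> G N \<and> (A j \<longrightarrow> R j \<subseteq> N)) \<tau> Ns"
  shows "\<exists>Ns'. list_all2 (\<lambda>j N. R j \<subseteq> N \<and> G N) (filter A \<tau>) Ns' \<and>
    set Ns' \<subseteq> set Ns \<and> loads P Ns' \<le> loads P Ns"
  using assms
proof (induction arbitrary: P rule: list_all2_induct)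
  case Nil
  then show ?case by simp
next
  case (Cons j \<tau> N Ns)
  obtain Ns' where Ns': "list_all2 (\<lambda>j N. R j \<subseteq> N \<and> G N) (filter A \<tau>) Ns'"
    "set Ns' \<subseteq> set Ns" "loads N Ns' \<le> loads N Ns" using Cons.IH by blast
  show ?case
  proof (cases "A j")
    case True
    then show ?thesis using Ns' Cons.hyps by (intro exI[of _ "N # Ns'"]) auto
  next
    case False
    have "finite X" if "X \<in> set Ns" for X
      using that Cons.hyps(2) by (metis (no_types, lifting) in_set_conv_nth list_all2_conv_all_nth)
    then have "loads P Ns' \<le> card (N - P) + loads N Ns'"
      using Cons.hyps(1) Ns'(2) by (intro loads_le_insert_front) auto
    then show ?thesis using False Ns' by (intro exI[of _ Ns']) auto
  qed
qed

section \<open>The lower bound\<close>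

lemma list_all2_rightD: "list_all2 (\<lambda>x y. P x y \<and> Q y) xs ys \<Longrightarrow> y \<in> set ys \<Longrightarrow> Q y"
  by (induction rule: list_all2_induct) auto

lemma Union_required_subset:
  "list_all2 (\<lambda>j M. R j \<subseteq> M) js Ms \<Longrightarrow> (\<Union>j\<in>set js. R j) \<subseteq> \<Union>(set Ms)"
  by (induction rule: list_all2_induct) auto

text \<open>
  Since \<open>s\<close> is processed with magazine \<open>Q\<close>, the sequence can be trimmed separately before and
  after it. The tools of \<open>Da\<close> occur before and those of \<open>Db\<close> after this position, and no job of
  \<open>A\<close> needs them there. As they are not in \<open>Q\<close>, none of their stays crosses this position, so
  removing them on their side saves at least one loading each and causes no new one.
\<close>

lemma min_switches_filter_save:
  assumes "c \<le> m" "s \<in> A"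
    and cov: "list_all2 (\<lambda>j M. R j \<subseteq> M \<and> magazine m c M) (as @ s # bs) (Ma @ Q # Mb)"
    and len: "length as = length Ma"
    and Da: "Da \<subseteq> \<Union>(set Ma) - Q" "\<And>j. j \<in> set as \<inter> A \<Longrightarrow> R j \<inter> Da = {}"
    and Db: "Db \<subseteq> \<Union>(set Mb) - Q" "\<And>j. j \<in> set bs \<inter> A \<Longrightarrow> R j \<inter> Db = {}"
  shows "min_switches m c R (filter (\<lambda>j. j \<in> A) (as @ s # bs))
    \<le> loads {} (Ma @ Q # Mb) - (card Da + card Db) - c"
proof -
  let ?G = "\<lambda>N. N \<subseteq> {1..m} \<and> card N \<le> c"
  let ?P = "\<lambda>j N. finite N \<and> ?G N \<and> (j \<in> A \<longrightarrow> R j \<subseteq> N)"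
  let ?Ns = "map (\<lambda>N. N - Da) Ma @ Q # map (\<lambda>N. N - Db) Mb"
  from cov len have cov': "list_all2 (\<lambda>j M. R j \<subseteq> M \<and> magazine m c M) as Ma"
    "R s \<subseteq> Q" "magazine m c Q" "list_all2 (\<lambda>j M. R j \<subseteq> M \<and> magazine m c M) bs Mb"
    by (auto simp: list_all2_append)
  have fin: "finite M" if "magazine m c M" for M
    using that finite_subset by (auto simp: magazine_def)
  have mags: "magazine m c M" if "M \<in> set (Ma @ Q # Mb)" for M
    using that cov list_all2_rightD by fast
  have small: "finite (M - D) \<and> ?G (M - D)" if "magazine m c M" for M D
    using that fin[OF that] card_mono[of M "M - D"] by (auto simp: magazine_def)
  have "list_all2 ?P as (map (\<lambda>N. N - Da) Ma)"
    unfolding list_all2_map2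
  proof (rule list.rel_mono_strong[OF cov'(1)])
    fix j M
    assume "j \<in> set as" "R j \<subseteq> M \<and> magazine m c M"
    then show "?P j (M - Da)" using small[of M Da] Da(2)[of j] by blast
  qed
  moreover have "list_all2 ?P bs (map (\<lambda>N. N - Db) Mb)"
    unfolding list_all2_map2
  proof (rule list.rel_mono_strong[OF cov'(4)])
    fix j M
    assume "j \<in> set bs" "R j \<subseteq> M \<and> magazine m c M"
    then show "?P j (M - Db)" using small[of M Db] Db(2)[of j] by blast
  qed
  moreover have "?P s Q" using cov'(2) small[OF cov'(3), of "{}"] by simp
  ultimately have "list_all2 ?P (as @ s # bs) ?Ns"
    by (simp add: list_all2_appendI)
  from ex_cover_of_filter[OF this, of "{}"] obtain Ns'
    where Ns': "list_all2 (\<lambda>j N. R j \<subseteq> N \<and> ?G N) (filter (\<lambda>j. j \<in> A) (as @ s # bs)) Ns'"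
      "loads {} Ns' \<le> loads {} ?Ns" by blast
  have "loads {} (map (\<lambda>N. N - Da) (Ma @ [Q])) + card Da \<le> loads {} (Ma @ [Q])"
    using Da(1) mags fin by (intro loads_remove) auto
  moreover have "loads Q (map (\<lambda>N. N - Db) Mb) + card Db \<le> loads Q Mb"
    using Db(1) mags fin by (intro loads_remove) auto
  moreover have "map (\<lambda>N. N - Da) (Ma @ [Q]) = map (\<lambda>N. N - Da) Ma @ [Q]"
    using Da(1) by auto
  ultimately have "loads {} ?Ns \<le> loads {} (Ma @ Q # Mb) - (card Da + card Db)"
    by (simp add: loads_split[of "{}" "map (\<lambda>N. N - Da) Ma" Q "map (\<lambda>N. N - Db) Mb"] loads_split[of "{}" Ma Q Mb])
  moreover have "filter (\<lambda>j. j \<in> A) (as @ s # bs) \<noteq> []" using assms(2) by simp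
  from min_switches_le_loads[OF this assms(1) Ns'(1)]
  have "min_switches m c R (filter (\<lambda>j. j \<in> A) (as @ s # bs)) \<le> loads {} Ns' - c" .
  ultimately show ?thesis using Ns'(2) by linarith
qed

text \<open>
  The minimum over \<open>S\<close> enters only through its value at the jobs of \<open>\<Omega>\<close> that precede the job at
  position \<open>p\<close> in \<open>\<tau>\<close>; all counting then refers to the magazine at that job.
\<close>

lemma L2_le_min_switches:
  assumes inst: "ssp_instance m n c R"
    and \<sigma>: "distinct \<sigma>" "p \<in> {1..length \<sigma>}" and \<Omega>: "\<Omega> \<subseteq> jobs_left n \<sigma>"
    and \<tau>: "distinct \<tau>" "set \<tau> = {1..n}" "filter (\<lambda>j. j \<in> set \<sigma>) \<tau> = \<sigma>"
  shows "L2 m c R \<sigma> p \<Omega> \<le> int (min_switches m c R \<tau>)"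
proof -
  define s where "s = job_at \<sigma> p"
  have p: "p - 1 < length \<sigma>" "Suc (p - 1) = p" using \<sigma>(2) by auto
  have \<sigma>_split: "\<sigma> = take (p - 1) \<sigma> @ s # drop p \<sigma>"
    using id_take_nth_drop[OF p(1)] p(2) by (simp add: s_def job_at_def)
  have "s \<in> set \<sigma>" by (subst \<sigma>_split) simp
  then have "s \<in> set \<tau>" using \<tau>(3) by (metis filter_is_subset subsetD)
  then obtain as bs where \<tau>_split: "\<tau> = as @ s # bs" by (meson split_list)
  let ?f = "filter (\<lambda>j. j \<in> set \<sigma>)"
  have "?f as @ s # ?f bs = take (p - 1) \<sigma> @ s # drop p \<sigma>"
    using \<tau>(3) \<sigma>_split \<tau>_split \<open>s \<in> set \<sigma>\<close> by simp
  moreover have "s \<notin> set (?f as)" "s \<notin> set (?f bs)" using \<tau>(1) \<tau>_split by simp_all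
  ultimately have "?f as = take (p - 1) \<sigma> \<and> ?f bs = drop p \<sigma>"
    using append_Cons_eq_iff[of s "?f as" "?f bs" "take (p - 1) \<sigma>" "drop p \<sigma>"] by blast
  then have fab: "take (p - 1) \<sigma> = ?f as" "drop p \<sigma> = ?f bs" by simp_all
  define Tl where "Tl = tools_of R (upto_pos \<sigma> p)"
  define Tr where "Tr = tools_of R (from_pos \<sigma> p)"
  have "upto_pos \<sigma> p = ?f as @ [s]"
    using take_Suc_conv_app_nth[OF p(1)] p(2) fab(1)
    by (simp add: upto_pos_def s_def job_at_def)
  then have Tl: "Tl = R s \<union> (\<Union>j\<in>set as \<inter> set \<sigma>. R j)"
    by (auto simp: Tl_def tools_of_def)
  have "from_pos \<sigma> p = s # ?f bs"
    using Cons_nth_drop_Suc[OF p(1)] p(2) fab(2)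
    by (simp add: from_pos_def s_def job_at_def)
  then have Tr: "Tr = R s \<union> (\<Union>j\<in>set bs \<inter> set \<sigma>. R j)"
    by (auto simp: Tr_def tools_of_def)
  have "set \<sigma> \<subseteq> set \<tau>" using \<tau>(3) by (metis filter_is_subset)
  then have "set \<sigma> = insert s ((set as \<union> set bs) \<inter> set \<sigma>)"
    using \<open>s \<in> set \<sigma>\<close> \<tau>_split by auto
  then have "tools_of R \<sigma> = (\<Union>j\<in>insert s ((set as \<union> set bs) \<inter> set \<sigma>). R j)"
    by (simp only: tools_of_def)
  then have T\<sigma>: "tools_of R \<sigma> = Tl \<union> Tr" by (auto simp: Tl Tr)
  define S where "S = \<Omega> \<inter> set as"
  have rest: "\<Omega> - S \<subseteq> set bs"
    using \<Omega> \<tau>(2) \<tau>_split \<open>s \<in> set \<sigma>\<close> by (auto simp: S_def jobs_left_def)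

  define X where "X = Tl \<inter> Tr - R s"
  define GR where "GR = Gamma_right R \<sigma> p S"
  define GL where "GL = Gamma_left R \<sigma> p (\<Omega> - S)"
  define GF where "GF = Gamma_free R \<sigma> \<Omega> S"
  define TS where "TS = (\<Union>j\<in>S. R j)"
  define TS' where "TS' = (\<Union>j\<in>\<Omega> - S. R j)"
  have GR: "GR = TS \<inter> Tr - Tl"
    by (simp add: GR_def Gamma_right_def TS_def Tl_def Tr_def)
  have GL: "GL = TS' \<inter> Tl - Tr"
    by (simp add: GL_def Gamma_left_def TS'_def Tl_def Tr_def)
  have GF: "GF = TS \<inter> TS' - (Tl \<union> Tr)"
    by (simp add: GF_def Gamma_free_def TS_def TS'_def T\<sigma>)
  define Ta where "Ta = (\<Union>j\<in>set as. R j)"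
  define Tb where "Tb = (\<Union>j\<in>set bs. R j)"
  have T_sub: "R s \<subseteq> Tl" "R s \<subseteq> Tr" "Tl \<subseteq> R s \<union> Ta" "Tr \<subseteq> R s \<union> Tb"
    by (auto simp: Tl Tr Ta_def Tb_def)
  have "TS \<subseteq> Ta" unfolding TS_def Ta_def by (rule UN_mono) (auto simp: S_def)
  moreover have "TS' \<subseteq> Tb" unfolding TS'_def Tb_def by (rule UN_mono) (use rest in auto)
  ultimately have between: "GR \<subseteq> Ta \<inter> Tb" "GL \<subseteq> Ta \<inter> Tb" "GF \<subseteq> Ta \<inter> Tb" "X \<subseteq> Ta \<inter> Tb"
    using T_sub by (auto simp: GR GL GF X_def)

  have "min_switches m c R \<tau> \<in> {switches Ms | Ms. covers m c R Ms \<tau>}"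
    unfolding min_switches_def
    by (rule Min_in[OF finite_switch_counts]) (use ex_covers[OF inst, of \<tau>] \<tau>(2) in auto)
  then obtain Ms where Ms: "covers m c R Ms \<tau>" "switches Ms = min_switches m c R \<tau>"
    by auto
  then have cov: "list_all2 (\<lambda>j M. R j \<subseteq> M \<and> magazine m c M) \<tau> Ms"
    by (auto simp: covers_def list_all2_conv_all_nth)
  then obtain Ma Q Mb where Ms_split: "Ms = Ma @ Q # Mb" and len: "length as = length Ma"
    unfolding \<tau>_split list_all2_append1 list_all2_Cons1 by metis
  have req: "list_all2 (\<lambda>j M. R j \<subseteq> M) as Ma" "list_all2 (\<lambda>j M. R j \<subseteq> M) bs Mb"
    "R s \<subseteq> Q" "magazine m c Q"
    using cov len unfolding \<tau>_split Ms_split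
    by (auto simp: list_all2_append elim: list_all2_mono)
  have present: "Ta \<subseteq> \<Union>(set Ma)" "Tb \<subseteq> \<Union>(set Mb)"
    unfolding Ta_def Tb_def using req(1,2) by (simp_all add: Union_required_subset)
  have mags: "M \<subseteq> {1..m}" "card M = c" "finite M" if "M \<in> set Ms" for M
    using that Ms(1) finite_subset by (auto simp: covers_def magazine_def)
  have loads: "loads {} Ms = min_switches m c R \<tau> + c"
  proof (cases Ms)
    case Nil
    then show ?thesis using Ms_split by simp
  next
    case (Cons M Ms')
    then show ?thesis using Ms(2) mags[of M] by (simp add: switches_Cons)
  qed
  have "(\<Union>j\<in>set \<tau>. R j) = {1..m}" using inst \<tau>(2) by (simp add: ssp_instance_def)
  then have bounded: "Ta \<union> Tb \<union> R s = {1..m}"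
    unfolding \<tau>_split Ta_def Tb_def by (simp add: Un_ac)
  have sub: "X \<subseteq> {1..m}" "GR \<subseteq> {1..m}" "GL \<subseteq> {1..m}" "GF \<subseteq> {1..m}" "R s \<subseteq> {1..m}"
    using between bounded by blast+
  have fin: "finite X" "finite GR" "finite GL" "finite GF" "finite (R s)"
    using sub by (meson finite_atLeastAtMost finite_subset)+
  have finQ: "finite Q" using mags Ms_split by simp

  define \<Gamma> where "\<Gamma> = GR \<union> GL \<union> GF"
  have fin\<Gamma>: "finite \<Gamma>" using fin by (simp add: \<Gamma>_def)
  have card\<Gamma>: "card GR + card GL + card GF = card \<Gamma>"
    using fin unfolding \<Gamma>_def
    by (subst card_Un_disjoint, (auto simp: GR GL GF)[3])+ simp
  have disj: "R s \<inter> \<Gamma> = {}" "R s \<inter> X = {}" "\<Gamma> \<inter> X = {}"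
    using T_sub by (auto simp: \<Gamma>_def GR GL GF X_def)
  \<comment> \<open>\<open>B\<close> and \<open>Y\<close> are the tools needed on both sides of \<open>s\<close> that \<open>Q\<close> does not keep.\<close>
  define B where "B = \<Gamma> - Q"
  define Y where "Y = X - Q"
  have BY: "finite B" "finite Y" "B \<inter> Y = {}" using fin fin\<Gamma> disj by (auto simp: B_def Y_def)
  have "card (R s) + card (\<Gamma> \<inter> Q) + card (X \<inter> Q) = card (R s \<union> \<Gamma> \<inter> Q \<union> X \<inter> Q)"
    using fin fin\<Gamma> disj by (subst card_Un_disjoint, auto)+
  also have "\<dots> \<le> card Q" using req(3) finQ by (intro card_mono) auto
  also have "\<dots> = c" using req(4) by (simp add: magazine_def)
  finally have "card (R s) + card (\<Gamma> \<inter> Q) + card (X \<inter> Q) \<le> c" .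
  then have room: "card (R s) + card \<Gamma> + card X \<le> c + card B + card Y"
    "card (R s) + card \<Gamma> \<le> c + card B"
    using card_Int_Diff[OF fin\<Gamma>, of Q] card_Int_Diff[OF fin(1), of Q]
    by (auto simp: B_def Y_def)

  let ?z = "min_switches m c R \<sigma>" and ?z\<tau> = "min_switches m c R \<tau>"
  have reload: "card (tools_of R \<sigma>) + card B + card Y \<le> ?z\<tau> + c"
  proof -
    have "card (tools_of R \<sigma>) + card (B \<union> Y) \<le> loads {} (Ma @ Q # Mb)"
    proof (rule card_plus_reloaded_le_loads)
      show "finite N" if "N \<in> set (Ma @ Q # Mb)" for N using that mags Ms_split by simp
      have "tools_of R \<sigma> \<subseteq> Ta \<union> R s \<union> Tb" using T_sub by (auto simp: T\<sigma>)
      then show "tools_of R \<sigma> \<subseteq> \<Union>(set (Ma @ Q # Mb))" using present req(3) by auto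
      show "B \<union> Y \<subseteq> \<Union>(set Ma) \<inter> \<Union>(set Mb) - Q"
        using between present by (auto simp: B_def Y_def \<Gamma>_def)
    qed
    then show ?thesis using loads BY by (simp add: card_Un_disjoint Ms_split)
  qed
  have all_tools: "m \<le> ?z\<tau> + c"
  proof -
    have "{1..m} \<subseteq> \<Union>(set Ms)" using bounded present req(3) by (auto simp: Ms_split)
    then have "card {1..m} \<le> card (\<Union>(set Ms))" using mags by (intro card_mono) auto
    then show ?thesis using card_Union_le_loads[of Ms "{}"] mags loads by simp
  qed
  have save: "?z \<le> ?z\<tau> - card B"
  proof -
    \<comment> \<open>Tools of \<open>GF\<close> could be removed on both sides; one side is enough.\<close>
    define Da where "Da = (GR \<union> GF) - Q"
    define Db where "Db = GL - Q"
    have "min_switches m c R (?f (as @ s # bs)) \<le> loads {} (Ma @ Q # Mb) - (card Da + card Db) - c"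
    proof (rule min_switches_filter_save)
      show "c \<le> m" using inst by (simp add: ssp_instance_def)
      show "Da \<subseteq> \<Union>(set Ma) - Q" "Db \<subseteq> \<Union>(set Mb) - Q"
        using between present by (auto simp: Da_def Db_def)
      show "R j \<inter> Da = {}" if "j \<in> set as \<inter> set \<sigma>" for j
        using that by (auto simp: Da_def GR GF Tl)
      show "R j \<inter> Db = {}" if "j \<in> set bs \<inter> set \<sigma>" for j
        using that by (auto simp: Db_def GL Tr)
    qed (use \<open>s \<in> set \<sigma>\<close> cov len in \<open>simp_all add: \<tau>_split Ms_split\<close>)
    moreover have "card Da + card Db = card B"
      unfolding B_def \<Gamma>_def Da_def Db_def using fin
      by (subst card_Un_disjoint[symmetric]) (auto simp: GR GL GF intro!: arg_cong[of _ _ card])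
    ultimately show ?thesis using \<tau>(3) loads by (simp add: \<tau>_split Ms_split)
  qed
  have "card (R s) + card \<Gamma> = card (R s \<union> \<Gamma>)"
    using fin(5) fin\<Gamma> disj(1) by (simp add: card_Un_disjoint)
  also have "\<dots> \<le> card {1..m}" using sub by (intro card_mono) (auto simp: \<Gamma>_def)
  finally have few: "card (R s) + card \<Gamma> \<le> m" by simp

  define \<mu> where "\<mu> = Min ((\<lambda>S. card (Gamma_right R \<sigma> p S) + card (Gamma_left R \<sigma> p (\<Omega> - S))
    + card (Gamma_free R \<sigma> \<Omega> S)) ` Pow \<Omega>)"
  have "finite \<Omega>" using \<Omega> finite_subset[of \<Omega> "{1..n}"] by (auto simp: jobs_left_def)
  then have "\<mu> \<le> card GR + card GL + card GF"
    unfolding \<mu>_def GR_def GL_def GF_def by (intro Min_le) (auto simp: S_def)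
  then have \<mu>: "\<mu> \<le> card \<Gamma>" using card\<Gamma> by simp
  have \<gamma>: "gamma m c R \<sigma> p = max (int (card X) - (int ?z - int (card (tools_of R \<sigma>)) + int c)) 0"
    by (simp add: gamma_def X_def Tl_def Tr_def s_def)
  have L2: "L2 m c R \<sigma> p \<Omega> = int ?z + max 0 (int (card (R s)) + int \<mu> + gamma m c R \<sigma> p - int c)"
    by (simp add: L2_def \<mu>_def s_def)
  \<comment> \<open>\<open>save\<close> settles the outer maximum \<open>0\<close>. Otherwise \<open>reload\<close> settles \<open>\<gamma> > 0\<close>, and \<open>save\<close> settles
    \<open>\<gamma> = 0\<close> unless \<open>z(\<sigma>) = 0\<close>, which needs \<open>few\<close> and \<open>all_tools\<close>.\<close>
  show ?thesis
    using L2 \<gamma> \<mu> room reload save few all_tools by linarith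
qed

theorem proposition2:
  fixes m n c p :: nat
    and R :: "nat \<Rightarrow> nat set"
    and root \<sigma> :: "nat list"
    and sel :: "nat list \<Rightarrow> nat"
    and \<Omega> :: "nat set"
  assumes "ssp_instance m n c R"
    and "pibb_tree n R root sel"
    and "\<sigma> \<in> subtree n sel root"
    and "p \<in> {1..length \<sigma>}"
    and "\<Omega> \<subseteq> jobs_left n \<sigma>"
  shows "L2 m c R \<sigma> p \<Omega> \<le> int (subproblem_opt m n c R sel \<sigma>) \<and>
    (\<forall>\<tau>\<in>completions n sel \<sigma>. L2 m c R \<sigma> p \<Omega> \<le> int (min_switches m c R \<tau>))"
proof -
  have bound: "L2 m c R \<sigma> p \<Omega> \<le> int (min_switches m c R \<tau>)" if "\<tau> \<in> completions n sel \<sigma>" for \<tau>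
    using that L2_le_min_switches[OF assms(1) node_distinct[OF assms(2,3)] assms(4,5)]
    unfolding node_completions[OF assms(2,3)] by blast
  have "subproblem_opt m n c R sel \<sigma> \<in> min_switches m c R ` completions n sel \<sigma>"
    unfolding subproblem_opt_def
    using finite_completions[OF assms(2,3)] completions_nonempty[OF assms(2,3)]
    by (intro Min_in) auto
  then show ?thesis using bound by auto
qed

end
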